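(* Consider the MI-NEP of the context. Suppose that Assumption A (with constants $\alpha\in[0,1)$ and $\mathbf w\in\mathbb R^N$, $w_\nu>0$) and Assumption B (with constant $\beta>0$) hold, and that $\max_{\nu\in\mathcal I}\sqrt{i_\nu}>0$. Let $\{\mathbf x^k\}_{k\in\mathbb N}\subseteq\Omega$ be a sequence generated by the Jacobi-type best-response method with index sets $\{\mathcal J^k\}_{k\in\mathbb N}$, and assume that there is an integer $h\ge1$ such that every $h$ iterations at least one best response of any player is computed, that is, $\nu\in\bigcup_{t=k}^{k+h-1}\mathcal J^t$ for every player $\nu\in\mathcal I$ and every iteration $k$. Let $\overline{\mathbf x}$ be the unique solution of the continuous NEP relaxation of the MI-NEP. (i) For every $\gamma\in(1,1/\alpha)$, the method generates a point $\mathbf x^k$ such that $$\max_{\nu\in\mathcal I} w_\nu\|x^{k,\nu}-\overline x^{\nu}\| < \beta\left(\frac{\gamma}{1-\gamma\alpha}\right)\max_{\nu\in\mathcal I}w_\nu\sqrt{i_\nu}\qquad(\star)$$ after at most $\widehat{\widehat k}_\gamma$ iterations, where $$\widehat{\widehat k}_\gamma := h\left\lceil \log_\gamma\left(\max\left\{\frac{(1-\gamma\alpha)\max_{\nu\in\mathcal I}w_\nu\|x^{0,\nu}-\overline x^{\nu}\|}{\beta\max_{\nu\in\mathcal I}w_\nu\sqrt{i_\nu}},\ \gamma\right\}\right)\right\rceil .$$ (ii) For every $\gamma\in(1,1/\alpha)$, any point $\mathbf x^k$ with $k\ge\widehat{\widehat k}_\gamma$ satisfies $(\star)$. (iii) The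 sequence $\{\mathbf x^k\}_{k\in\mathbb N}$ has at least one cluster point, and every cluster point $\widetilde{\mathbf x}$ is contained in $\Omega$ and satisfies $$\max_{\nu\in\mathcal I}w_\nu\|\widetilde x^\nu-\overline x^{\nu}\|\le \beta\left(\frac{1}{1-\alpha}\right)\max_{\nu\in\mathcal I}w_\nu\sqrt{i_\nu}.$$
   Context: MI-NEP (mixed-integer Nash equilibrium problem). There are $N$ players, $\mathcal I=\{1,\dots,N\}$. Player $\nu$ controls $x^\nu\in\mathbb R^{n_\nu}$; $\mathbf x=(x^\nu)_{\nu\in\mathcal I}\in\mathbb R^n$, $n=\sum_\nu n_\nu$; $\mathbf x^{-\nu}$ collects the strategies of all players other than $\nu$, and one writes $\mathbf x=(x^\nu,\mathbf x^{-\nu})$. Given $\mathbf x^{-\nu}$, player $\nu$ solves $$\min_{x^\nu}\ \theta_\nu(x^\nu,\mathbf x^{-\nu})\quad\text{s.t. } x^\nu\in\Omega_\nu:=\{x^\nu\in X_\nu \mid x^\nu_j\in\mathbb Z,\ j=1,\dots,i_\nu\},$$ where $\theta_\nu:\mathbb R^n\to\mathbb R$ is continuously differentiable and convex with respect to $x^\nu$, $X_\nu\subseteq\mathbb R^{n_\nu}$ is closed and convex (possibly unbounded), $0\le i_\nu\le n_\nu$ is an integer, and $\Omega_\nu\neq\emptyset$. Put $\Omega=\prod_\nu\Omega_\nu$, $X=\prod_\nu X_\nu$, $\Omega_{-\nu}=\prod_{\nu'\ne\nu}\Omega_{\nu'}$. Standing assumption: each player's problem has a solution for every given $\mathbf x^{-\nu}$.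 Best responses: $R_\nu(\mathbf x^{-\nu})=\arg\min\{\theta_\nu(x^\nu,\mathbf x^{-\nu}) : x^\nu\in\Omega_\nu\}$ (mixed-integer) and $T_\nu(\mathbf x^{-\nu})=\arg\min\{\theta_\nu(x^\nu,\mathbf x^{-\nu}) : x^\nu\in X_\nu\}$ (continuous). It is assumed throughout that $T=(T_\nu)_\nu$ is single-valued on $X$. The continuous NEP relaxation is the game in which each $\Omega_\nu$ is replaced by $X_\nu$; a solution of it is $\overline{\mathbf x}\in X$ with $\overline x^\nu=T_\nu(\overline{\mathbf x}^{-\nu})$ for all $\nu$. Under Assumption A it exists and is unique. $\|\cdot\|$ is any given norm. Assumption A: there exist $\alpha\in[0,1)$ and $\mathbf w\in\mathbb R^N$ with $w_\nu>0$ for all $\nu$ such that for all $\mathbf z,\mathbf y\in X$: $\max_{\nu}w_\nu\|T_\nu(\mathbf z^{-\nu})-T_\nu(\mathbf y^{-\nu})\|\le\alpha\max_\nu w_\nu\|z^\nu-y^\nu\|$. Assumption B: there exists $\beta>0$ such that for all $\nu\in\mathcal I$ and $\mathbf z^{-\nu}\in\Omega_{-\nu}$: $\|\widehat x^\nu-T_\nu(\mathbf z^{-\nu})\|\le\beta\sqrt{i_\nu}$ for all $\widehat x^\nu\in R_\nu(\mathbf z^{-\nu})$. Jacobi-type best-response method: start from $\mathbf x^0\in\Omega$; at each iteration $k=0,1,\dots$ select a subset $\mathcal J^k\subseteq\mathcal I$; for $\nu\in\mathcal J^k$ choose any $x^{k+1,\nu}\in R_\nu(\mathbf x^{k,-\nu})$;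 for $\nu\notin\mathcal J^k$ set $x^{k+1,\nu}=x^{k,\nu}$. Convention: $1/\alpha=+\infty$ if $\alpha=0$. *)

theory Defs
  imports "HOL-Analysis.Analysis"
begin

text \<open>
  The players are the elements of a finite type \<open>'p\<close> and the joint strategies live in
  \<open>real ^ 'n\<close>. As the dimension of the strategy space varies with the player, \<open>coord G \<nu> j\<close>
  gives the position in the joint vector of the \<open>j\<close>-th coordinate of player \<open>\<nu>\<close>, where
  \<open>1 \<le> j \<le> ndim G \<nu>\<close>; the predicate \<open>mi_nep\<close> below requires these positions to enumerate
  \<open>'n\<close> without repetition, so that \<open>CARD('n)\<close> is the sum of the dimensions.
  A vector of player \<open>\<nu>\<close> is represented by the element of \<open>real ^ 'n\<close> that carries its entries
  in the positions of \<open>\<nu>\<close> and vanishes elsewhere.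
  The first \<open>nint G \<nu>\<close> coordinates of player \<open>\<nu>\<close> are the integer ones; \<open>cset G \<nu>\<close> is the
  feasible set of the continuous relaxation.
\<close>

record ('p, 'n::finite) game =
  ndim :: "'p \<Rightarrow> nat"
  nint :: "'p \<Rightarrow> nat"
  coord :: "'p \<Rightarrow> nat \<Rightarrow> 'n"
  cost :: "'p \<Rightarrow> real ^ 'n \<Rightarrow> real"
  cset :: "'p \<Rightarrow> (real ^ 'n) set"

definition coords :: "('p, 'n::finite) game \<Rightarrow> 'p \<Rightarrow> 'n set" where
  "coords G \<nu> = coord G \<nu> ` {1..ndim G \<nu>}"

definition strat_space :: "('p, 'n::finite) game \<Rightarrow> 'p \<Rightarrow> (real ^ 'n) set" where
  "strat_space G \<nu> = {u. \<forall>c. c \<notin> coords G \<nu> \<longrightarrow> u $ c = 0}"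

definition block :: "('p, 'n::finite) game \<Rightarrow> 'p \<Rightarrow> real ^ 'n \<Rightarrow> real ^ 'n" where
  "block G \<nu> x = (\<chi> c. if c \<in> coords G \<nu> then x $ c else 0)"

text \<open>
  \<open>join G \<nu> u x\<close> is the profile composed of the strategy \<open>u\<close> of player \<open>\<nu>\<close> and the strategies
  of the other players in \<open>x\<close>. It does not depend on the entries of \<open>x\<close> that belong to \<open>\<nu>\<close>;
  functions of the rivals' strategies are therefore written as functions of the whole profile.
\<close>

definition join :: "('p, 'n::finite) game \<Rightarrow> 'p \<Rightarrow> real ^ 'n \<Rightarrow> real ^ 'n \<Rightarrow> real ^ 'n" where
  "join G \<nu> u x = (\<chi> c. if c \<in> coords G \<nu> then u $ c else x $ c)"

definition mi_set :: "('p, 'n::finite) game \<Rightarrow> 'p \<Rightarrow> (real ^ 'n) set" where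
  "mi_set G \<nu> = {u \<in> cset G \<nu>. \<forall>j\<in>{1..nint G \<nu>}. u $ coord G \<nu> j \<in> \<int>}"

definition profiles :: "('p, 'n::finite) game \<Rightarrow> ('p \<Rightarrow> (real ^ 'n) set) \<Rightarrow> (real ^ 'n) set" where
  "profiles G S = {x. \<forall>\<nu>. block G \<nu> x \<in> S \<nu>}"

definition rival_profiles ::
  "('p, 'n::finite) game \<Rightarrow> ('p \<Rightarrow> (real ^ 'n) set) \<Rightarrow> 'p \<Rightarrow> (real ^ 'n) set" where
  "rival_profiles G S \<nu> = {x. \<forall>\<mu>. \<mu> \<noteq> \<nu> \<longrightarrow> block G \<mu> x \<in> S \<mu>}"

definition best_responses ::
  "('p, 'n::finite) game \<Rightarrow> ('p \<Rightarrow> (real ^ 'n) set) \<Rightarrow> 'p \<Rightarrow> real ^ 'n \<Rightarrow> (real ^ 'n) set" where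
  "best_responses G S \<nu> x =
     {u. is_arg_min (\<lambda>v. cost G \<nu> (join G \<nu> v x)) (\<lambda>v. v \<in> S \<nu>) u}"

abbreviation mi_best_responses ::
  "('p, 'n::finite) game \<Rightarrow> 'p \<Rightarrow> real ^ 'n \<Rightarrow> (real ^ 'n) set" where
  "mi_best_responses G \<equiv> best_responses G (mi_set G)"

definition cont_single_valued :: "('p, 'n::finite) game \<Rightarrow> bool" where
  "cont_single_valued G \<longleftrightarrow>
     (\<forall>x\<in>profiles G (cset G). \<forall>\<nu>. is_singleton (best_responses G (cset G) \<nu> x))"

text \<open>Meaningful only where the set of best responses is a singleton.\<close>

definition cont_best_response :: "('p, 'n::finite) game \<Rightarrow> 'p \<Rightarrow> real ^ 'n \<Rightarrow> real ^ 'n" where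
  "cont_best_response G \<nu> x = the_elem (best_responses G (cset G) \<nu> x)"

definition continuously_differentiable :: "(real ^ 'n \<Rightarrow> real) \<Rightarrow> bool" where
  "continuously_differentiable f \<longleftrightarrow>
     (\<exists>g :: real ^ 'n \<Rightarrow> real ^ 'n.
        (\<forall>x. (f has_derivative (\<lambda>h. g x \<bullet> h)) (at x)) \<and> continuous_on UNIV g)"

definition mi_nep :: "('p::finite, 'n::finite) game \<Rightarrow> bool" where
  "mi_nep G \<longleftrightarrow>
     bij_betw (\<lambda>(\<nu>, j). coord G \<nu> j) (SIGMA \<nu>:UNIV. {1..ndim G \<nu>}) UNIV \<and>
     (\<forall>\<nu>. nint G \<nu> \<le> ndim G \<nu> \<and>
          cset G \<nu> \<subseteq> strat_space G \<nu> \<and> closed (cset G \<nu>) \<and> convex (cset G \<nu>) \<and>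
          mi_set G \<nu> \<noteq> {} \<and>
          continuously_differentiable (cost G \<nu>) \<and>
          (\<forall>x. convex_on (strat_space G \<nu>) (\<lambda>u. cost G \<nu> (join G \<nu> u x))) \<and>
          (\<forall>x\<in>rival_profiles G (mi_set G) \<nu>. mi_best_responses G \<nu> x \<noteq> {}))"

definition norm_on :: "'a::real_vector set \<Rightarrow> ('a \<Rightarrow> real) \<Rightarrow> bool" where
  "norm_on V f \<longleftrightarrow>
     (\<forall>u\<in>V. 0 \<le> f u \<and> (f u = 0 \<longleftrightarrow> u = 0)) \<and>
     (\<forall>u\<in>V. \<forall>c. f (c *\<^sub>R u) = \<bar>c\<bar> * f u) \<and>
     (\<forall>u\<in>V. \<forall>v\<in>V. f (u + v) \<le> f u + f v)"

definition wdist ::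
  "('p::finite, 'n::finite) game \<Rightarrow> ('p \<Rightarrow> real ^ 'n \<Rightarrow> real) \<Rightarrow> real ^ 'p \<Rightarrow>
   real ^ 'n \<Rightarrow> real ^ 'n \<Rightarrow> real" where
  "wdist G nrm w x y = (MAX \<nu>. w $ \<nu> * nrm \<nu> (block G \<nu> x - block G \<nu> y))"

definition assumption_A ::
  "('p::finite, 'n::finite) game \<Rightarrow> ('p \<Rightarrow> real ^ 'n \<Rightarrow> real) \<Rightarrow> real \<Rightarrow> real ^ 'p \<Rightarrow> bool" where
  "assumption_A G nrm \<alpha> w \<longleftrightarrow>
     0 \<le> \<alpha> \<and> \<alpha> < 1 \<and> (\<forall>\<nu>. 0 < w $ \<nu>) \<and>
     (\<forall>z\<in>profiles G (cset G). \<forall>y\<in>profiles G (cset G).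
        (MAX \<nu>. w $ \<nu> * nrm \<nu> (cont_best_response G \<nu> z - cont_best_response G \<nu> y))
          \<le> \<alpha> * wdist G nrm w z y)"

definition assumption_B ::
  "('p, 'n::finite) game \<Rightarrow> ('p \<Rightarrow> real ^ 'n \<Rightarrow> real) \<Rightarrow> real \<Rightarrow> bool" where
  "assumption_B G nrm \<beta> \<longleftrightarrow>
     0 < \<beta> \<and>
     (\<forall>\<nu>. \<forall>z\<in>rival_profiles G (mi_set G) \<nu>. \<forall>u\<in>mi_best_responses G \<nu> z.
        nrm \<nu> (u - cont_best_response G \<nu> z) \<le> \<beta> * sqrt (real (nint G \<nu>)))"

definition relaxation_solution :: "('p, 'n::finite) game \<Rightarrow> real ^ 'n \<Rightarrow> bool" where
  "relaxation_solution G x \<longleftrightarrow>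
     x \<in> profiles G (cset G) \<and> (\<forall>\<nu>. block G \<nu> x = cont_best_response G \<nu> x)"

definition jacobi_sequence ::
  "('p, 'n::finite) game \<Rightarrow> (nat \<Rightarrow> 'p set) \<Rightarrow> (nat \<Rightarrow> real ^ 'n) \<Rightarrow> bool" where
  "jacobi_sequence G J x \<longleftrightarrow>
     x 0 \<in> profiles G (mi_set G) \<and>
     (\<forall>k \<nu>. if \<nu> \<in> J k then block G \<nu> (x (Suc k)) \<in> mi_best_responses G \<nu> (x k)
            else block G \<nu> (x (Suc k)) = block G \<nu> (x k))"

definition cluster_point :: "(nat \<Rightarrow> 'a::topological_space) \<Rightarrow> 'a \<Rightarrow> bool" where
  "cluster_point x l \<longleftrightarrow> (\<exists>r. strict_mono r \<and> (x \<circ> r) \<longlonglongrightarrow> l)"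

definition wint :: "('p::finite, 'n::finite) game \<Rightarrow> real ^ 'p \<Rightarrow> real" where
  "wint G w = (MAX \<nu>. w $ \<nu> * sqrt (real (nint G \<nu>)))"

text \<open>The ceiling is at least 1, as the argument of the logarithm is at least \<open>\<gamma> > 1\<close>.\<close>

definition iteration_bound :: "nat \<Rightarrow> real \<Rightarrow> real \<Rightarrow> real \<Rightarrow> real \<Rightarrow> real \<Rightarrow> nat" where
  "iteration_bound h \<alpha> \<beta> \<gamma> d m =
     h * nat \<lceil>log \<gamma> (max ((1 - \<gamma> * \<alpha>) * d / (\<beta> * m)) \<gamma>)\<rceil>"

end

theory Submission
  imports Defs
begin

text \<open>
  In the weighted maximum norm a mixed-integer best response is a contraction step perturbed by at
  most \<open>C = \<beta> * wint G w\<close>. If all players are within \<open>B \<ge> C / (1 - \<alpha>)\<close> of the solution, they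
  remain so, and each player is within \<open>C + \<alpha> * B\<close> from its first update on; hence every \<open>h\<close>
  iterations the excess of the distance over the fixed point \<open>C / (1 - \<alpha>)\<close> of \<open>B \<mapsto> C + \<alpha> * B\<close>
  shrinks by the factor \<open>\<alpha>\<close>.
\<close>

section \<open>Perturbed contractions with delayed updates\<close>

text \<open>Here \<open>e k i\<close> stands for the weighted error of player \<open>i\<close> at
  iteration \<open>k\<close>. Quantifying \<open>upd\<close> over every common bound
  \<open>B\<close> avoids maxima over players. Once a player has reached
  \<open>C + \<alpha> * B\<close>, idling preserves this and a further update establishes it
  again.\<close>

lemma perturbed_contraction_window:
  fixes e :: "nat \<Rightarrow> 'p \<Rightarrow> real"
  assumes upd: "\<And>k i B. i \<in> J k \<Longrightarrow> \<forall>j. e k j \<le> B \<Longrightarrow> e (Suc k) i \<le> C + \<alpha> * B"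
    and keep: "\<And>k i. i \<notin> J k \<Longrightarrow> e (Suc k) i = e k i"
    and window: "\<And>i k. i \<in> (\<Union>t\<in>{k..k + h - 1}. J t)"
    and h: "h \<ge> 1"
    and start: "\<And>i. e k i \<le> B"
    and B: "C + \<alpha> * B \<le> B"
  shows "l \<ge> k \<Longrightarrow> e l i \<le> B" and "l \<ge> k + h \<Longrightarrow> e l i \<le> C + \<alpha> * B"
proof -
  \<comment> \<open>All players are treated at once, since one player's update depends on the errors
    of all.\<close>
  have stay: "\<forall>i. e l i \<le> B" if "l \<ge> k" for l
    using that
  proof (induction l rule: dec_induct)
    case base
    show ?case using start by blast
  next
    case (step l)
    show ?case
    proof
      fix i
      show "e (Suc l) i \<le> B"
        using upd[of i l B] keep[of i l] step.IH B by (cases "i \<in> J l") force+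
    qed
  qed
  then show "l \<ge> k \<Longrightarrow> e l i \<le> B" by blast
  assume l: "l \<ge> k + h"
  obtain t where t: "t \<ge> k" "t \<le> k + h - 1" "i \<in> J t" using window[of i k] by auto
  \<comment> \<open>As \<open>h \<ge> 1\<close>, \<open>k + h - 1\<close> is the true predecessor of
    \<open>k + h\<close>, so the effect of the update at \<open>t\<close> is visible by iteration
    \<open>k + h\<close>.\<close>
  have "Suc t \<le> l" using t l h by linarith
  then show "e l i \<le> C + \<alpha> * B"
  proof (induction l rule: dec_induct)
    case base
    show ?case using upd[OF t(3)] stay[OF t(1)] by blast
  next
    case (step l)
    have "\<forall>j. e l j \<le> B" using stay[of l] step.hyps t by simp
    then show ?case using upd[of i l B] keep[of i l] step.IH by (cases "i \<in> J l") auto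
  qed
qed

lemma perturbed_contraction_rate:
  fixes e :: "nat \<Rightarrow> 'p \<Rightarrow> real"
  assumes upd: "\<And>k i B. i \<in> J k \<Longrightarrow> \<forall>j. e k j \<le> B \<Longrightarrow> e (Suc k) i \<le> C + \<alpha> * B"
    and keep: "\<And>k i. i \<notin> J k \<Longrightarrow> e (Suc k) i = e k i"
    and window: "\<And>i k. i \<in> (\<Union>t\<in>{k..k + h - 1}. J t)"
    and h: "h \<ge> 1"
    and \<alpha>: "0 \<le> \<alpha>" "\<alpha> < 1"
    and M: "0 \<le> M" "\<And>i. e 0 i \<le> C / (1 - \<alpha>) + M"
    and k: "k \<ge> h * m"
  shows "e k i \<le> C / (1 - \<alpha>) + \<alpha> ^ m * M"
  using k
proof (induction m arbitrary: k i)
  have fixed: "C + \<alpha> * (C / (1 - \<alpha>) + q) = C / (1 - \<alpha>) + \<alpha> * q" for q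
    using \<alpha> by (simp add: field_simps)
  \<comment> \<open>A bound is preserved only if it lies above the fixed point; this is why the
    excess \<open>M\<close> must be nonnegative.\<close>
  have le: "C + \<alpha> * (C / (1 - \<alpha>) + q) \<le> C / (1 - \<alpha>) + q" if "0 \<le> q" for q
    unfolding fixed using \<alpha> that by (simp add: mult_left_le_one_le)
  {
    case 0
    show ?case
      using perturbed_contraction_window(1)[of J e C \<alpha> h 0 "C / (1 - \<alpha>) + M" k i,
          OF upd keep window h M(2) le[OF M(1)]] by simp
  next
    case (Suc m)
    have "C + \<alpha> * (C / (1 - \<alpha>) + \<alpha> ^ m * M) \<le> C / (1 - \<alpha>) + \<alpha> ^ m * M"
      using \<alpha> M(1) by (intro le) simp
    from perturbed_contraction_window(2)[of J e C \<alpha> h "h * m" "C / (1 - \<alpha>) + \<alpha> ^ m * M" k i,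
        OF upd keep window h Suc.IH[OF order_refl] this] Suc.prems
    show ?case unfolding fixed by (simp add: algebra_simps)
  }
qed

text \<open>If \<open>d\<close> exceeds the fixed point, the left side is \<open>C\<close> times the
  geometric sum of \<open>\<alpha> ^ i\<close> for \<open>i < m\<close>, plus
  \<open>\<alpha> ^ m * d\<close>. The sum is at most that of
  \<open>(\<gamma> * \<alpha>) ^ i\<close>, and the hypothesis on \<open>d\<close> bounds the last
  term by \<open>C * (\<gamma> * \<alpha>) ^ m / (1 - \<gamma> * \<alpha>)\<close>. The two bounds
  add up to exactly \<open>C / (1 - \<gamma> * \<alpha>)\<close>, and \<open>\<gamma> > 1\<close>
  gives strictness.\<close>

lemma perturbed_contraction_threshold:
  fixes \<alpha> \<gamma> C d :: real
  assumes \<alpha>: "0 \<le> \<alpha>" "\<alpha> < 1" and \<gamma>: "1 < \<gamma>" "\<gamma> * \<alpha> < 1" and C: "0 < C"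
    and d: "(1 - \<gamma> * \<alpha>) * d / C \<le> \<gamma> ^ m"
  shows "C / (1 - \<alpha>) + \<alpha> ^ m * max 0 (d - C / (1 - \<alpha>)) < C * (\<gamma> / (1 - \<gamma> * \<alpha>))"
proof (cases "d \<le> C / (1 - \<alpha>)")
  case True
  have "1 / (1 - \<alpha>) < \<gamma> / (1 - \<gamma> * \<alpha>)" using \<alpha> \<gamma> by (simp add: field_simps)
  then have "C * (1 / (1 - \<alpha>)) < C * (\<gamma> / (1 - \<gamma> * \<alpha>))" using C by (rule mult_strict_left_mono)
  then show ?thesis using True by simp
next
  case False
  have geo: "(1 - q ^ m) / (1 - q) = (\<Sum>i<m. q ^ i)" if "q < 1" for q :: real
    using that by (simp add: sum_gp_strict)
  have "\<alpha> \<le> \<gamma> * \<alpha>" using \<alpha> \<gamma> by (simp add: mult_le_cancel_right1)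
  then have "(\<Sum>i<m. \<alpha> ^ i) \<le> (\<Sum>i<m. (\<gamma> * \<alpha>) ^ i)"
    using \<alpha> by (intro sum_mono power_mono)
  then have 1: "(1 - \<alpha> ^ m) / (1 - \<alpha>) \<le> (1 - (\<gamma> * \<alpha>) ^ m) / (1 - \<gamma> * \<alpha>)"
    using geo \<alpha> \<gamma> by simp
  have "d \<le> C * (\<gamma> ^ m / (1 - \<gamma> * \<alpha>))" using d C \<gamma> by (simp add: field_simps)
  then have "\<alpha> ^ m * d \<le> \<alpha> ^ m * (C * (\<gamma> ^ m / (1 - \<gamma> * \<alpha>)))"
    using \<alpha> by (intro mult_left_mono) auto
  then have 2: "\<alpha> ^ m * d \<le> C * ((\<gamma> * \<alpha>) ^ m / (1 - \<gamma> * \<alpha>))"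
    by (simp add: power_mult_distrib mult_ac)
  have "C / (1 - \<alpha>) + \<alpha> ^ m * max 0 (d - C / (1 - \<alpha>)) = C * ((1 - \<alpha> ^ m) / (1 - \<alpha>)) + \<alpha> ^ m * d"
    using False by (simp add: algebra_simps diff_divide_distrib)
  also have "\<dots> \<le> C * ((1 - (\<gamma> * \<alpha>) ^ m) / (1 - \<gamma> * \<alpha>)) + C * ((\<gamma> * \<alpha>) ^ m / (1 - \<gamma> * \<alpha>))"
    using C 1 2 by (intro add_mono mult_left_mono) auto
  also have "\<dots> = C * (1 / (1 - \<gamma> * \<alpha>))"
    by (simp add: distrib_left[symmetric] add_divide_distrib[symmetric])
  also have "\<dots> < C * (\<gamma> / (1 - \<gamma> * \<alpha>))"
    using C \<gamma> by (intro mult_strict_left_mono divide_strict_right_mono) auto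
  finally show ?thesis .
qed

lemma le_power_ceiling_log:
  assumes "1 < \<gamma>" "0 < a" "a \<le> A"
  shows "a \<le> \<gamma> ^ nat \<lceil>log \<gamma> A\<rceil>"
proof -
  have "A = \<gamma> powr log \<gamma> A" using assms by simp
  \<comment> \<open>Should the ceiling be negative, \<open>nat\<close> raises it to 0, which only
    enlarges the exponent.\<close>
  also have "\<dots> \<le> \<gamma> powr real (nat \<lceil>log \<gamma> A\<rceil>)" using assms by (intro powr_mono) linarith+
  also have "\<dots> = \<gamma> ^ nat \<lceil>log \<gamma> A\<rceil>" using assms by (simp add: powr_realpow)
  finally show ?thesis using assms by simp
qed

section \<open>Equivalence of norms on a subspace\<close>

lemma norm_on_triangle:
  assumes "norm_on V f" "subspace V" "a \<in> V" "b \<in> V" "c \<in> V"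
  shows "f (a - c) \<le> f (a - b) + f (b - c)"
proof -
  have "f ((a - b) + (b - c)) \<le> f (a - b) + f (b - c)"
    using assms by (metis norm_on_def subspace_diff)
  then show ?thesis by simp
qed

lemma norm_on_minus_commute:
  assumes "norm_on V f" "subspace V" "a \<in> V" "b \<in> V"
  shows "f (a - b) = f (b - a)"
proof -
  have "f ((-1) *\<^sub>R (b - a)) = \<bar>-1\<bar> * f (b - a)"
    using assms by (metis norm_on_def subspace_diff)
  then show ?thesis by simp
qed

text \<open>Expanding \<open>u\<close> in an orthonormal basis of \<open>V\<close> bounds each
  coefficient by \<open>norm u\<close>, so the sum of \<open>f\<close> over the basis serves as
  \<open>K\<close>.\<close>

lemma norm_on_upper_bound:
  fixes V :: "'a::euclidean_space set"
  assumes f: "norm_on V f" and V: "subspace V"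
  obtains K where "0 \<le> K" "\<And>u. u \<in> V \<Longrightarrow> f u \<le> K * norm u"
proof -
  obtain B where B: "B \<subseteq> V" "pairwise orthogonal B" "\<And>b. b \<in> B \<Longrightarrow> norm b = 1"
    "independent B" "span B = V"
    using orthonormal_basis_subspace[OF V] by metis
  have fin: "finite B" using B(4) by (rule independent_imp_finite)
  have sub: "f (\<Sum>b\<in>S. g b *\<^sub>R b) \<le> (\<Sum>b\<in>S. \<bar>g b\<bar> * f b)" if "finite S" "S \<subseteq> B" for g S
    using that
  proof (induction S rule: finite_induct)
    case empty
    show ?case using f subspace_0[OF V] by (auto simp: norm_on_def)
  next
    case (insert b S)
    have bV: "b \<in> V" "S \<subseteq> V" using insert.prems B(1) by auto
    have "(\<Sum>b\<in>S. g b *\<^sub>R b) \<in> V"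
      using V bV by (intro subspace_sum subspace_scale) auto
    moreover have "g b *\<^sub>R b \<in> V" using V bV by (simp add: subspace_scale)
    ultimately have "f (g b *\<^sub>R b + (\<Sum>b\<in>S. g b *\<^sub>R b)) \<le> f (g b *\<^sub>R b) + f (\<Sum>b\<in>S. g b *\<^sub>R b)"
      using f by (simp add: norm_on_def)
    moreover have "f (g b *\<^sub>R b) = \<bar>g b\<bar> * f b" using f bV by (simp add: norm_on_def)
    ultimately show ?case using insert by simp
  qed
  show thesis
  proof
    show "0 \<le> (\<Sum>b\<in>B. f b)" using f B(1) by (intro sum_nonneg) (auto simp: norm_on_def)
    fix u assume u: "u \<in> V"
    have "f u = f (\<Sum>b\<in>B. (u \<bullet> b) *\<^sub>R b)"
      using orthonormal_basis_expand[OF B(2,3) _ fin, of u] u B(5) by simp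
    also have "\<dots> \<le> (\<Sum>b\<in>B. \<bar>u \<bullet> b\<bar> * f b)" by (rule sub[OF fin order_refl])
    also have "\<dots> \<le> (\<Sum>b\<in>B. norm u * f b)"
    proof (intro sum_mono mult_right_mono)
      fix b assume b: "b \<in> B"
      show "\<bar>u \<bullet> b\<bar> \<le> norm u" using Cauchy_Schwarz_ineq2[of u b] B(3)[OF b] by simp
      show "0 \<le> f b" using f B(1) b by (auto simp: norm_on_def)
    qed
    finally show "f u \<le> (\<Sum>b\<in>B. f b) * norm u" by (simp add: sum_distrib_left mult.commute)
  qed
qed

text \<open>The reverse triangle inequality and the upper bound make \<open>f\<close> Lipschitz on
  \<open>V\<close>.\<close>

lemma norm_on_continuous:
  fixes V :: "'a::euclidean_space set"
  assumes f: "norm_on V f" and V: "subspace V"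
  shows "continuous_on V f"
proof -
  obtain K where K: "0 \<le> K" "\<And>u. u \<in> V \<Longrightarrow> f u \<le> K * norm u"
    using norm_on_upper_bound[OF f V] by blast
  have "\<bar>f u - f v\<bar> \<le> K * norm (u - v)" if "u \<in> V" "v \<in> V" for u v
  proof -
    have "f u \<le> f (u - v) + f v" "f v \<le> f (v - u) + f u"
      using norm_on_triangle[OF f V, of _ _ 0] that subspace_0[OF V] by force+
    moreover have "f (v - u) = f (u - v)"
      using that by (rule norm_on_minus_commute[OF f V, rotated])
    ultimately show ?thesis using K(2)[of "u - v"] subspace_diff[OF V that] by linarith
  qed
  then have "K-lipschitz_on V f"
    using K(1) by (auto simp: lipschitz_on_def dist_norm)
  then show ?thesis by (rule lipschitz_on_continuous_on)
qed

text \<open>The unit sphere of \<open>V\<close> is compact, so the continuous \<open>f\<close>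
  attains a positive minimum on it; homogeneity carries this over to all of
  \<open>V\<close>.\<close>

lemma norm_on_lower_bound:
  fixes V :: "'a::euclidean_space set"
  assumes f: "norm_on V f" and V: "subspace V"
  obtains c where "0 < c" "\<And>u. u \<in> V \<Longrightarrow> c * norm u \<le> f u"
proof (cases "V \<inter> sphere 0 1 = {}")
  \<comment> \<open>The sphere misses \<open>V\<close> only if \<open>V\<close> is trivial, as for a
    player without coordinates; any positive constant then works.\<close>
  case True
  have "u = 0" if "u \<in> V" for u
  proof (rule ccontr)
    assume "u \<noteq> 0"
    then have "(1 / norm u) *\<^sub>R u \<in> V \<inter> sphere 0 1" using that V by (simp add: subspace_scale)
    with True show False by blast
  qed
  then show ?thesis using that[of 1] f by (force simp: norm_on_def)
next
  case False
  have "compact (V \<inter> sphere 0 1)" using V by (simp add: closed_subspace closed_Int_compact)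
  moreover have "continuous_on (V \<inter> sphere 0 1) f"
    using norm_on_continuous[OF f V] by (rule continuous_on_subset) simp
  ultimately obtain s where s: "s \<in> V" "norm s = 1" "\<And>u. u \<in> V \<Longrightarrow> norm u = 1 \<Longrightarrow> f s \<le> f u"
    using continuous_attains_inf[OF _ False, of f] by auto
  show ?thesis
  proof (rule that)
    show "0 < f s" using f s(1,2) by (auto simp: norm_on_def less_le)
    fix u assume u: "u \<in> V"
    show "f s * norm u \<le> f u"
    proof (cases "u = 0")
      case True
      then show ?thesis using f u by (simp add: norm_on_def)
    next
      case False
      have "f s \<le> f ((1 / norm u) *\<^sub>R u)" using s(3) u V False by (simp add: subspace_scale)
      also have "\<dots> = \<bar>1 / norm u\<bar> * f u" using f u unfolding norm_on_def by blast
      finally show ?thesis using False by (simp add: field_simps)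
    qed
  qed
qed

section \<open>Topology of blocks, profiles and the weighted distance\<close>

lemma subspace_strat_space: "subspace (strat_space G \<nu>)"
  by (auto simp: subspace_def strat_space_def)

lemma block_in_strat_space: "block G \<nu> x \<in> strat_space G \<nu>"
  by (simp add: block_def strat_space_def)

lemma continuous_on_block: "continuous_on UNIV (block G \<nu>)"
  unfolding block_def
proof (rule continuous_on_vec_lambda)
  fix i show "continuous_on UNIV (\<lambda>x. if i \<in> coords G \<nu> then x $ i else 0)"
    by (cases "i \<in> coords G \<nu>") (auto intro: continuous_intros)
qed

lemma wdist_le_iff:
  "wdist G nrm w x y \<le> b \<longleftrightarrow> (\<forall>\<nu>. w $ \<nu> * nrm \<nu> (block G \<nu> x - block G \<nu> y) \<le> b)"
  by (simp add: wdist_def)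

lemma coords_cover:
  assumes "mi_nep G"
  obtains \<nu> where "c \<in> coords G \<nu>"
proof -
  have "c \<in> (\<lambda>(\<nu>, j). coord G \<nu> j) ` (SIGMA \<nu>:UNIV. {1..ndim G \<nu>})"
    using assms by (simp add: mi_nep_def bij_betw_def)
  then show thesis using that by (auto simp: coords_def)
qed

text \<open>Every entry of \<open>x\<close> lies in some block, and the Euclidean norm is at most
  the sum of the absolute entries. The crude factor suffices for boundedness.\<close>

lemma norm_le_sum_norm_block:
  fixes G :: "('p::finite, 'n::finite) game"
  assumes "mi_nep G"
  shows "norm x \<le> CARD('n) * (\<Sum>\<nu>\<in>UNIV. norm (block G \<nu> x))"
proof -
  have "\<bar>x $ c\<bar> \<le> (\<Sum>\<nu>\<in>UNIV. norm (block G \<nu> x))" for c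
  proof -
    obtain \<nu> where "c \<in> coords G \<nu>" using coords_cover[OF assms] .
    then have "\<bar>x $ c\<bar> \<le> norm (block G \<nu> x)"
      using component_le_norm_cart[of "block G \<nu> x" c] by (simp add: block_def)
    also have "\<dots> \<le> (\<Sum>\<nu>\<in>UNIV. norm (block G \<nu> x))"
      by (rule member_le_sum) auto
    finally show ?thesis .
  qed
  then have "(\<Sum>c\<in>UNIV. \<bar>x $ c\<bar>) \<le> (\<Sum>c::'n\<in>UNIV. \<Sum>\<nu>\<in>UNIV. norm (block G \<nu> x))"
    by (intro sum_mono)
  then show ?thesis using norm_le_l1_cart[of x] by simp
qed

text \<open>The lower bounds on the players' norms turn a bound on the weighted distance into
  Euclidean bounds on all blocks, which together cover the vector. This supplies the compactness for
  the existence of a cluster point.\<close>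

lemma bounded_wdist_le:
  fixes G :: "('p::finite, 'n::finite) game"
  assumes nep: "mi_nep G"
    and nrm: "\<And>\<nu>. norm_on (strat_space G \<nu>) (nrm \<nu>)"
    and w: "\<And>\<nu>. 0 < w $ \<nu>"
  shows "bounded {y. wdist G nrm w y z \<le> b}"
proof -
  have "\<exists>c>0. \<forall>u\<in>strat_space G \<nu>. c * norm u \<le> nrm \<nu> u" for \<nu>
  proof -
    obtain c where "0 < c" "\<And>u. u \<in> strat_space G \<nu> \<Longrightarrow> c * norm u \<le> nrm \<nu> u"
      using norm_on_lower_bound[OF nrm[of \<nu>] subspace_strat_space] by metis
    then show ?thesis by blast
  qed
  then obtain c where "\<forall>\<nu>. 0 < c \<nu> \<and> (\<forall>u\<in>strat_space G \<nu>. c \<nu> * norm u \<le> nrm \<nu> u)"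
    by metis
  then have c: "0 < c \<nu>" "u \<in> strat_space G \<nu> \<Longrightarrow> c \<nu> * norm u \<le> nrm \<nu> u" for \<nu> u
    by simp_all
  have blk: "norm (block G \<nu> y) \<le> norm (block G \<nu> z) + b / (w $ \<nu> * c \<nu>)"
    if "wdist G nrm w y z \<le> b" for y \<nu>
  proof -
    let ?d = "block G \<nu> y - block G \<nu> z"
    have "?d \<in> strat_space G \<nu>"
      by (intro subspace_diff subspace_strat_space block_in_strat_space)
    then have "w $ \<nu> * (c \<nu> * norm ?d) \<le> w $ \<nu> * nrm \<nu> ?d"
      using c(2) w[of \<nu>] by (intro mult_left_mono) auto
    also have "\<dots> \<le> b" using that by (simp add: wdist_le_iff)
    finally have "norm ?d \<le> b / (w $ \<nu> * c \<nu>)"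
      using c(1)[of \<nu>] w[of \<nu>] by (simp add: field_simps)
    then show ?thesis using norm_triangle_ineq2[of "block G \<nu> y" "block G \<nu> z"] by linarith
  qed
  have "norm y \<le> CARD('n) * (\<Sum>\<nu>\<in>UNIV. norm (block G \<nu> z) + b / (w $ \<nu> * c \<nu>))"
    if "wdist G nrm w y z \<le> b" for y
  proof -
    have "(\<Sum>\<nu>\<in>UNIV. norm (block G \<nu> y)) \<le> (\<Sum>\<nu>\<in>UNIV. norm (block G \<nu> z) + b / (w $ \<nu> * c \<nu>))"
      by (intro sum_mono blk that)
    then have "real CARD('n) * (\<Sum>\<nu>\<in>UNIV. norm (block G \<nu> y))
        \<le> CARD('n) * (\<Sum>\<nu>\<in>UNIV. norm (block G \<nu> z) + b / (w $ \<nu> * c \<nu>))"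
      by (intro mult_left_mono) auto
    then show ?thesis using norm_le_sum_norm_block[OF nep, of y] by linarith
  qed
  then show ?thesis by (intro boundedI) simp
qed

text \<open>Continuity of \<open>nrm \<nu>\<close> is known only on the strategy space, so the
  differences have to be kept inside that subspace.\<close>

lemma tendsto_norm_on_block_diff:
  assumes nrm: "norm_on (strat_space G \<nu>) (nrm \<nu>)" and y: "y \<longlonglongrightarrow> l"
  shows "(\<lambda>k. nrm \<nu> (block G \<nu> (y k) - block G \<nu> z)) \<longlonglongrightarrow> nrm \<nu> (block G \<nu> l - block G \<nu> z)"
proof (rule continuous_on_tendsto_compose[OF norm_on_continuous[OF nrm subspace_strat_space]])
  have "(\<lambda>k. block G \<nu> (y k)) \<longlonglongrightarrow> block G \<nu> l"
    using continuous_on_tendsto_compose[OF continuous_on_block y] by simp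
  then show "(\<lambda>k. block G \<nu> (y k) - block G \<nu> z) \<longlonglongrightarrow> block G \<nu> l - block G \<nu> z"
    by (intro tendsto_intros)
qed (auto intro!: subspace_diff subspace_strat_space block_in_strat_space always_eventually)

text \<open>Integrality and membership in \<open>cset\<close> are closed conditions on continuous
  images of the profile. Cluster points of feasible iterates are therefore feasible.\<close>

lemma closed_mi_profiles:
  assumes "mi_nep G"
  shows "closed (profiles G (mi_set G))"
proof -
  have "closed (mi_set G \<nu>)" for \<nu>
  proof -
    have "mi_set G \<nu> = cset G \<nu> \<inter> (\<Inter>j\<in>{1..nint G \<nu>}. (\<lambda>u. u $ coord G \<nu> j) -` \<int>)"
      by (auto simp: mi_set_def)
    moreover have "closed ((\<lambda>u::real ^ 'b. u $ coord G \<nu> j) -` \<int>)" for j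
      by (intro closed_vimage closed_Ints continuous_intros)
    moreover have "closed (cset G \<nu>)" using assms by (simp add: mi_nep_def)
    ultimately show ?thesis by (simp add: closed_Int closed_INT)
  qed
  then have "closed (\<Inter>\<nu>. block G \<nu> -` mi_set G \<nu>)"
    by (intro closed_INT ballI closed_vimage continuous_on_block)
  moreover have "profiles G (mi_set G) = (\<Inter>\<nu>. block G \<nu> -` mi_set G \<nu>)"
    by (auto simp: profiles_def)
  ultimately show ?thesis by simp
qed

section \<open>Best responses and the Jacobi iteration\<close>

lemma best_responses_feasible: "u \<in> best_responses G S \<nu> x \<Longrightarrow> u \<in> S \<nu>"
  by (auto simp: best_responses_def is_arg_min_def)

lemma jacobi_sequence_feasible:
  assumes "jacobi_sequence G J x"
  shows "x k \<in> profiles G (mi_set G)"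
proof (induction k)
  case 0
  show ?case using assms by (simp add: jacobi_sequence_def)
next
  case (Suc k)
  have "block G \<nu> (x (Suc k)) \<in> mi_set G \<nu>" for \<nu>
  proof (cases "\<nu> \<in> J k")
    case True
    then have "block G \<nu> (x (Suc k)) \<in> mi_best_responses G \<nu> (x k)"
      using assms by (simp add: jacobi_sequence_def)
    then show ?thesis by (rule best_responses_feasible)
  next
    case False
    then have "block G \<nu> (x (Suc k)) = block G \<nu> (x k)"
      using assms by (simp add: jacobi_sequence_def)
    then show ?thesis using Suc.IH by (simp add: profiles_def)
  qed
  then show ?case by (simp add: profiles_def)
qed

lemma cont_best_response_in_cset:
  assumes "cont_single_valued G" "x \<in> profiles G (cset G)"
  shows "cont_best_response G \<nu> x \<in> cset G \<nu>"
proof -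
  have "is_singleton (best_responses G (cset G) \<nu> x)"
    using assms by (simp add: cont_single_valued_def)
  then obtain u where u: "best_responses G (cset G) \<nu> x = {u}" by (rule is_singletonE)
  then have "cont_best_response G \<nu> x \<in> best_responses G (cset G) \<nu> x"
    by (simp add: cont_best_response_def)
  then show ?thesis by (rule best_responses_feasible)
qed

text \<open>The triangle inequality is applied through the continuous best response to
  \<open>y\<close>: Assumption B bounds the distance from \<open>u\<close> to it, and Assumption A
  contracts its distance to \<open>block G \<nu> xbar\<close>, the continuous best response to
  \<open>xbar\<close>.\<close>

lemma mi_best_response_error:
  assumes nep: "mi_nep G"
    and nrm: "norm_on (strat_space G \<nu>) (nrm \<nu>)"
    and sv: "cont_single_valued G"
    and A: "assumption_A G nrm \<alpha> w"
    and B: "assumption_B G nrm \<beta>"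
    and sol: "relaxation_solution G xbar"
    and y: "y \<in> profiles G (mi_set G)"
    and u: "u \<in> mi_best_responses G \<nu> y"
  shows "w $ \<nu> * nrm \<nu> (u - block G \<nu> xbar) \<le> \<beta> * wint G w + \<alpha> * wdist G nrm w y xbar"
proof -
  let ?T = "cont_best_response G \<nu>"
  \<comment> \<open>Feasibility for the relaxation allows Assumption A to be applied at the
    mixed-integer point \<open>y\<close>.\<close>
  have yc: "y \<in> profiles G (cset G)" using y by (auto simp: profiles_def mi_set_def)
  have xc: "xbar \<in> profiles G (cset G)" and xT: "block G \<nu> xbar = ?T xbar"
    using sol by (auto simp: relaxation_solution_def)
  have sub: "cset G \<nu> \<subseteq> strat_space G \<nu>" using nep by (simp add: mi_nep_def)
  have "u \<in> mi_set G \<nu>" using u by (rule best_responses_feasible)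
  then have mem: "u \<in> strat_space G \<nu>" "?T y \<in> strat_space G \<nu>" "?T xbar \<in> strat_space G \<nu>"
    using sub cont_best_response_in_cset[OF sv] yc xc by (auto simp: mi_set_def)
  have w: "0 < w $ \<nu>" using A by (simp add: assumption_A_def)
  have "nrm \<nu> (u - ?T y) \<le> \<beta> * sqrt (real (nint G \<nu>))"
    using B y u by (auto simp: assumption_B_def rival_profiles_def profiles_def)
  then have "w $ \<nu> * nrm \<nu> (u - ?T y) \<le> w $ \<nu> * (\<beta> * sqrt (real (nint G \<nu>)))"
    using w by (intro mult_left_mono) auto
  also have "\<dots> = \<beta> * (w $ \<nu> * sqrt (real (nint G \<nu>)))" by simp
  also have "\<dots> \<le> \<beta> * wint G w"
    using B by (intro mult_left_mono) (auto simp: assumption_B_def wint_def)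
  finally have 1: "w $ \<nu> * nrm \<nu> (u - ?T y) \<le> \<beta> * wint G w" .
  have "w $ \<nu> * nrm \<nu> (?T y - ?T xbar) \<le>
      (MAX \<nu>. w $ \<nu> * nrm \<nu> (cont_best_response G \<nu> y - cont_best_response G \<nu> xbar))"
    by (intro Max_ge) auto
  also have "\<dots> \<le> \<alpha> * wdist G nrm w y xbar"
    using A yc xc by (simp add: assumption_A_def)
  finally have 2: "w $ \<nu> * nrm \<nu> (?T y - ?T xbar) \<le> \<alpha> * wdist G nrm w y xbar" .
  have "nrm \<nu> (u - ?T xbar) \<le> nrm \<nu> (u - ?T y) + nrm \<nu> (?T y - ?T xbar)"
    by (rule norm_on_triangle[OF nrm subspace_strat_space mem])
  then have "w $ \<nu> * nrm \<nu> (u - ?T xbar) \<le> w $ \<nu> * (nrm \<nu> (u - ?T y) + nrm \<nu> (?T y - ?T xbar))"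
    using w by (intro mult_left_mono) auto
  then show ?thesis using 1 2 xT by (simp add: distrib_left)
qed

text \<open>Some player has an integer variable. The resulting positivity of
  \<open>\<beta> * wint G w\<close> justifies the quotient in \<open>iteration_bound\<close> and the
  strict inequality of the first two claims.\<close>

lemma wint_pos:
  assumes "\<And>\<nu>. 0 < w $ \<nu>" "(MAX \<nu>. sqrt (real (nint G \<nu>))) > 0"
  shows "0 < wint G w"
proof -
  obtain \<nu> where "0 < sqrt (real (nint G \<nu>))"
    using assms(2) by (subst (asm) Max_gr_iff) auto
  then have "0 < w $ \<nu> * sqrt (real (nint G \<nu>))" using assms(1)[of \<nu>] by simp
  then show ?thesis unfolding wint_def by (subst Max_gr_iff) auto
qed

section \<open>Convergence of the Jacobi-type method\<close>

theorem theorem4: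
  fixes G :: "('p::finite, 'n::finite) game"
    and nrm :: "'p \<Rightarrow> real ^ 'n \<Rightarrow> real"
    and \<alpha> \<beta> :: real
    and w :: "real ^ 'p"
    and x :: "nat \<Rightarrow> real ^ 'n"
    and J :: "nat \<Rightarrow> 'p set"
    and h :: nat
    and xbar :: "real ^ 'n"
  assumes "mi_nep G"
    and "\<And>\<nu>. norm_on (strat_space G \<nu>) (nrm \<nu>)"
    and "cont_single_valued G"
    and "assumption_A G nrm \<alpha> w"
    and "assumption_B G nrm \<beta>"
    and "(MAX \<nu>. sqrt (real (nint G \<nu>))) > 0"
    and "jacobi_sequence G J x"
    and "h \<ge> 1"
    and "\<And>\<nu> k. \<nu> \<in> (\<Union>t\<in>{k..k + h - 1}. J t)"
    and "relaxation_solution G xbar"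
  shows
    "(\<forall>\<gamma>. 1 < \<gamma> \<and> (\<alpha> = 0 \<or> \<gamma> < 1 / \<alpha>) \<longrightarrow>
        (\<exists>k \<le> iteration_bound h \<alpha> \<beta> \<gamma> (wdist G nrm w (x 0) xbar) (wint G w).
           wdist G nrm w (x k) xbar < \<beta> * (\<gamma> / (1 - \<gamma> * \<alpha>)) * wint G w)) \<and>
     (\<forall>\<gamma>. 1 < \<gamma> \<and> (\<alpha> = 0 \<or> \<gamma> < 1 / \<alpha>) \<longrightarrow>
        (\<forall>k \<ge> iteration_bound h \<alpha> \<beta> \<gamma> (wdist G nrm w (x 0) xbar) (wint G w).
           wdist G nrm w (x k) xbar < \<beta> * (\<gamma> / (1 - \<gamma> * \<alpha>)) * wint G w)) \<and>
     (\<exists>xt. cluster_point x xt) \<and>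
     (\<forall>xt. cluster_point x xt \<longrightarrow>
        xt \<in> profiles G (mi_set G) \<and>
        wdist G nrm w xt xbar \<le> \<beta> * (1 / (1 - \<alpha>)) * wint G w)"
proof -
  note nep = assms(1) and nrm = assms(2) and A = assms(4) and B = assms(5) and jac = assms(7)
  let ?d = "\<lambda>k. wdist G nrm w (x k) xbar"
  define C where "C = \<beta> * wint G w"
  \<comment> \<open>\<open>L\<close> is the fixed point of the perturbed contraction and
    \<open>M\<close> the initial excess over it, cut off at 0 in case the start is already within
    \<open>L\<close>.\<close>
  define L where "L = C / (1 - \<alpha>)"
  define M where "M = max 0 (?d 0 - L)"
  define e where "e = (\<lambda>k \<nu>. w $ \<nu> * nrm \<nu> (block G \<nu> (x k) - block G \<nu> xbar))"
  have \<alpha>: "0 \<le> \<alpha>" "\<alpha> < 1" and w: "\<And>\<nu>. 0 < w $ \<nu>" and \<beta>: "0 < \<beta>"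
    using A B by (auto simp: assumption_A_def assumption_B_def)
  have wi: "0 < wint G w" using w assms(6) by (rule wint_pos)
  then have C: "0 < C" using \<beta> by (simp add: C_def)
  have d_le: "?d k \<le> b \<longleftrightarrow> (\<forall>\<nu>. e k \<nu> \<le> b)" for k b
    by (simp add: wdist_le_iff e_def)
  have upd: "e (Suc k) \<nu> \<le> C + \<alpha> * b" if "\<nu> \<in> J k" "\<forall>\<mu>. e k \<mu> \<le> b" for k \<nu> b
  proof -
    have "block G \<nu> (x (Suc k)) \<in> mi_best_responses G \<nu> (x k)"
      using jac that(1) by (simp add: jacobi_sequence_def)
    then have "e (Suc k) \<nu> \<le> C + \<alpha> * ?d k"
      unfolding e_def C_def
      by (rule mi_best_response_error[OF nep nrm assms(3) A B assms(10) jacobi_sequence_feasible[OF jac]])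
    moreover have "\<alpha> * ?d k \<le> \<alpha> * b" using that(2) d_le \<alpha> by (intro mult_left_mono) auto
    ultimately show ?thesis by linarith
  qed
  have keep: "e (Suc k) \<nu> = e k \<nu>" if "\<nu> \<notin> J k" for k \<nu>
    using jac that by (simp add: jacobi_sequence_def e_def)
  have e0: "e 0 \<nu> \<le> C / (1 - \<alpha>) + M" for \<nu>
  proof -
    have "e 0 \<nu> \<le> ?d 0" using d_le by blast
    then show ?thesis by (simp add: M_def L_def)
  qed
  have "0 \<le> M" by (simp add: M_def)
  then have rate: "?d k \<le> L + \<alpha> ^ m * M" if "k \<ge> h * m" for k m
    using perturbed_contraction_rate[where e = e and J = J, OF upd keep assms(9,8) \<alpha> _ e0 that]
    by (simp add: d_le L_def)
  \<comment> \<open>The first claim is the instance of this one in which \<open>k\<close> equals the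
    bound.\<close>
  have ii: "?d k < \<beta> * (\<gamma> / (1 - \<gamma> * \<alpha>)) * wint G w"
    if \<gamma>: "1 < \<gamma> \<and> (\<alpha> = 0 \<or> \<gamma> < 1 / \<alpha>)"
      and k: "k \<ge> iteration_bound h \<alpha> \<beta> \<gamma> (?d 0) (wint G w)" for \<gamma> k
  proof -
    define m where "m = nat \<lceil>log \<gamma> (max ((1 - \<gamma> * \<alpha>) * ?d 0 / C) \<gamma>)\<rceil>"
    \<comment> \<open>Division by zero yields 0, so the convention for \<open>1 / \<alpha>\<close>
      is expressed by the separate case \<open>\<alpha> = 0\<close>.\<close>
    have \<gamma>\<alpha>: "\<gamma> * \<alpha> < 1" using \<gamma> \<alpha> by (cases "\<alpha> = 0") (auto simp: field_simps)
    \<comment> \<open>The maximum with \<open>\<gamma>\<close> keeps the argument of the logarithm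
      positive.\<close>
    have "max ((1 - \<gamma> * \<alpha>) * ?d 0 / C) \<gamma> \<le> \<gamma> ^ m"
      unfolding m_def using \<gamma> by (intro le_power_ceiling_log) auto
    then have "L + \<alpha> ^ m * M < C * (\<gamma> / (1 - \<gamma> * \<alpha>))"
      unfolding L_def M_def using \<gamma> \<gamma>\<alpha> \<alpha> C by (intro perturbed_contraction_threshold) auto
    moreover have "?d k \<le> L + \<alpha> ^ m * M"
      using k by (intro rate) (simp add: iteration_bound_def m_def C_def)
    ultimately show ?thesis by (simp add: C_def mult_ac)
  qed
  have cluster: "\<exists>xt. cluster_point x xt"
  proof -
    \<comment> \<open>The rate with \<open>m = 0\<close> bounds the whole sequence.\<close>
    have "range x \<subseteq> {y. wdist G nrm w y xbar \<le> L + M}" using rate[of 0] by auto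
    then have "bounded (range x)" using bounded_wdist_le[OF nep nrm w] bounded_subset by blast
    then show ?thesis using bounded_imp_convergent_subsequence unfolding cluster_point_def by blast
  qed
  have bound: "xt \<in> profiles G (mi_set G) \<and> wdist G nrm w xt xbar \<le> L" if xt: "cluster_point x xt" for xt
  proof
    obtain r where r: "strict_mono r" "(x \<circ> r) \<longlonglongrightarrow> xt" using xt by (auto simp: cluster_point_def)
    show "xt \<in> profiles G (mi_set G)"
      using closed_sequentially[OF closed_mi_profiles[OF nep] _ r(2)] jacobi_sequence_feasible[OF jac]
      by simp
    \<comment> \<open>For fixed \<open>m\<close>, the terms of the subsequence with index
      \<open>k \<ge> h * m\<close> obey the rate because \<open>r k \<ge> k\<close>. The limit in
      \<open>k\<close> is taken first and the limit in \<open>m\<close> afterwards, which removes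
      the excess.\<close>
    have "w $ \<nu> * nrm \<nu> (block G \<nu> xt - block G \<nu> xbar) \<le> L + \<alpha> ^ m * M" for \<nu> m
    proof (rule LIMSEQ_le_const2)
      show "(\<lambda>k. w $ \<nu> * nrm \<nu> (block G \<nu> ((x \<circ> r) k) - block G \<nu> xbar))
          \<longlonglongrightarrow> w $ \<nu> * nrm \<nu> (block G \<nu> xt - block G \<nu> xbar)"
        by (intro tendsto_mult_left tendsto_norm_on_block_diff nrm r)
      have "e (r k) \<nu> \<le> L + \<alpha> ^ m * M" if "k \<ge> h * m" for k
        using rate[of m "r k"] that seq_suble[OF r(1), of k] d_le by force
      then show "\<exists>N. \<forall>k\<ge>N. w $ \<nu> * nrm \<nu> (block G \<nu> ((x \<circ> r) k) - block G \<nu> xbar) \<le> L + \<alpha> ^ m * M"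
        by (auto simp: e_def)
    qed
    moreover have "(\<lambda>m. L + \<alpha> ^ m * M) \<longlonglongrightarrow> L + 0 * M"
      using \<alpha> by (intro tendsto_intros LIMSEQ_power_zero) auto
    ultimately show "wdist G nrm w xt xbar \<le> L"
      unfolding wdist_le_iff using LIMSEQ_le_const by fastforce
  qed
  have "L = \<beta> * (1 / (1 - \<alpha>)) * wint G w" by (simp add: L_def C_def)
  then show ?thesis using ii cluster bound by blast
qed

end
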